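(* Let $n \ge 2$ and $N \ge 1$ be integers. For $f,g \in \mathcal{E}$ (defined below) one has $E f \ge 0$ and $E(fg) \ge (E f)(E g)$, where $$E f = \int f(\sigma_1,\dots,\sigma_N)\, d\sigma_1 \cdots d\sigma_N$$ and each $d\sigma_i$ is normalized Lebesgue (uniform probability) measure on the unit sphere $\mathbb{S}^{n-1}\subset\mathbb{R}^n$.
   Context: Variables $\sigma_1,\dots,\sigma_N$ range over $\mathbb{S}^{n-1}$, and $\sigma_i\cdot\sigma_j$ denotes the Euclidean inner product in $\mathbb{R}^n$. $\mathcal{E}$ is the set of (finite) linear combinations with positive coefficients of monomials of the form $\prod_{1\le i<j\le N} (\sigma_i\cdot\sigma_j)^{n_{i,j}}$, where the $n_{i,j}\ge 0$ are integers. *)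

theory Defs
  imports "HOL-Analysis.Analysis"
begin

text \<open>Normalized (probability) surface measure on the unit sphere of \<open>real^'n\<close>,
  realised as the cone measure: the image of the uniform probability measure on the
  unit ball under radial projection \<open>x \<mapsto> x / norm x\<close> (i.e. \<open>sgn\<close>).  For a Borel set
  \<open>A\<close> of the sphere this gives \<open>vol{t x | x\<in>A, 0<t\<le>1} / vol(ball 0 1)\<close>, which is
  the normalized Lebesgue (surface) measure of \<open>A\<close>.\<close>
definition sphere_measure :: "(real^'n) measure" where
  "sphere_measure = distr (uniform_measure lborel (ball 0 1)) borel sgn"

definition sphere_prod :: "nat \<Rightarrow> (nat \<Rightarrow> real^'n) measure" where
  "sphere_prod N = PiM {..<N} (\<lambda>_. sphere_measure)"

definition Exp :: "nat \<Rightarrow> ((nat \<Rightarrow> real^'n) \<Rightarrow> real) \<Rightarrow> real" where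
  "Exp N f = integral\<^sup>L (sphere_prod N) f"

definition monomial :: "nat \<Rightarrow> (nat \<Rightarrow> nat \<Rightarrow> nat) \<Rightarrow> (nat \<Rightarrow> real^'n) \<Rightarrow> real" where
  "monomial N e \<sigma> = (\<Prod>i<N. \<Prod>j\<in>{i<..<N}. (\<sigma> i \<bullet> \<sigma> j) ^ (e i j))"

definition posmono :: "nat \<Rightarrow> ((nat \<Rightarrow> real^'n) \<Rightarrow> real) set" where
  "posmono N = {f. \<exists>(K::nat set) (c::nat \<Rightarrow> real) (e::nat \<Rightarrow> nat \<Rightarrow> nat \<Rightarrow> nat).
      finite K \<and> K \<noteq> {} \<and> (\<forall>k\<in>K. c k > 0) \<and>
      f = (\<lambda>\<sigma>. \<Sum>k\<in>K. c k * monomial N (e k) \<sigma>)}"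

end

theory Submission
  imports Defs "HOL-Probability.Infinite_Product_Measure"
begin

text \<open>Consider the cone generated by products of inner products \<open>\<sigma> i \<bullet> \<sigma> j\<close>. Integrating out one
  vertex maps it to itself: by rotation invariance the integral of \<open>(x \<bullet> w) ^ m\<close> is a nonnegative
  multiple of \<open>norm w ^ m\<close>, and polarization turns this into an expression for the integral of a product
  of factors \<open>x \<bullet> v\<close> as a combination of products of inner products of the \<open>v\<close> with nonnegative
  coefficients. Hence integrals are nonnegative. Moreover, identifying two vertices increases the
  integral: once all the others are integrated out, what remains is a polynomial in
  \<open>\<sigma> i \<bullet> \<sigma> j\<close> with nonnegative coefficients, whose mean is at most its value at 1.
  Finally \<open>E f * E g\<close> is the integral of \<open>f \<sigma> * g \<tau>\<close> over two independent copies of the variables,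
  and identifying \<open>\<tau> i\<close> with \<open>\<sigma> i\<close> for one \<open>i\<close> after the other leads to \<open>E (f g)\<close>.\<close>

section \<open>Rotation invariance and moments\<close>

lemma emeasure_unit_ball:
  "emeasure lborel (ball (0::'a::euclidean_space) 1) \<noteq> 0"
  "emeasure lborel (ball (0::'a::euclidean_space) 1) \<noteq> \<infinity>"
  by (auto simp: emeasure_ball unit_ball_vol_pos less_imp_neq[symmetric] ennreal_eq_0_iff not_le)

lemma orthogonal_transformation_borel_measurable:
  fixes f :: "'a::euclidean_space \<Rightarrow> 'a"
  assumes "orthogonal_transformation f"
  shows "f \<in> borel_measurable borel"
  using orthogonal_transformation_linear[OF assms]
  by (intro borel_measurable_continuous_onI linear_continuous_on linear_conv_bounded_linear[THEN iffD1])

text \<open>Integrate \<open>indicator A (f x + y) * indicator B y\<close>, for the unit ball \<open>B\<close>, in both orders.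
  (\<open>measure_orthogonal_image\<close> needs a well-ordered index type.)\<close>
lemma distr_lborel_orthogonal_transformation:
  fixes f :: "'a::euclidean_space \<Rightarrow> 'a"
  assumes f: "orthogonal_transformation f"
  shows "distr lborel borel f = lborel"
proof (rule measure_eqI)
  fix A :: "'a set" assume "A \<in> sets (distr lborel borel f)"
  then have A[measurable]: "A \<in> sets borel" by simp
  have lin: "linear f" by (rule orthogonal_transformation_linear[OF f])
  have f_meas[measurable]: "f \<in> borel_measurable borel"
    by (rule orthogonal_transformation_borel_measurable[OF f])
  obtain g where g: "f (g x) = x" for x
    using orthogonal_transformation_surj[OF f] by (metis surjD)
  define B :: "'a set" where "B = ball 0 1"
  have B[measurable]: "B \<in> sets borel" by (simp add: B_def)
  have shift: "(\<integral>\<^sup>+x. h (c + x) \<partial>lborel) = integral\<^sup>N lborel h"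
    if [measurable]: "h \<in> borel_measurable borel" for h :: "'a \<Rightarrow> ennreal" and c
    by (subst (2) lborel_distr_plus[of c, symmetric]) (simp add: nn_integral_distr)
  let ?I = "\<lambda>x y. indicator A (f x + y) * indicator B y :: ennreal"
  have "(\<integral>\<^sup>+x. \<integral>\<^sup>+y. ?I x y \<partial>lborel \<partial>lborel) = (\<integral>\<^sup>+y. \<integral>\<^sup>+x. ?I x y \<partial>lborel \<partial>lborel)"
    by (rule lborel_pair.Fubini'[symmetric]) measurable
  also have "\<dots> = (\<integral>\<^sup>+y. emeasure lborel (f -` A) * indicator B y \<partial>lborel)"
  proof (rule nn_integral_cong)
    fix y
    \<comment> \<open>Since \<open>y = f (g y)\<close>, linearity gives
      \<open>f x + y = f (g y + x)\<close>, and translation by \<open>g y\<close> removes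
      \<open>y\<close> from the inner integral.\<close>
    have "(\<integral>\<^sup>+x. ?I x y \<partial>lborel) = (\<integral>\<^sup>+x. indicator A (f (g y + x)) \<partial>lborel) * indicator B y"
      by (subst nn_integral_multc) (auto simp: linear_add[OF lin] g add.commute)
    also have "(\<integral>\<^sup>+x. indicator A (f (g y + x)) \<partial>lborel) = (\<integral>\<^sup>+x. indicator A (f x) \<partial>lborel)"
      by (rule shift) measurable
    also have "\<dots> = (\<integral>\<^sup>+x. indicator (f -` A) x \<partial>lborel)"
      by (simp add: indicator_vimage o_def)
    also have "\<dots> = emeasure lborel (f -` A)"
      using measurable_sets[OF f_meas A] by (intro nn_integral_indicator) simp
    finally show "(\<integral>\<^sup>+x. ?I x y \<partial>lborel) = emeasure lborel (f -` A) * indicator B y" .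
  qed
  also have "\<dots> = emeasure lborel (f -` A) * emeasure lborel B"
    by (simp add: nn_integral_cmult)
  finally have 1: "(\<integral>\<^sup>+x. \<integral>\<^sup>+y. ?I x y \<partial>lborel \<partial>lborel) = emeasure lborel (f -` A) * emeasure lborel B" .
  have "(\<integral>\<^sup>+x. \<integral>\<^sup>+y. ?I x y \<partial>lborel \<partial>lborel)
      = (\<integral>\<^sup>+x. \<integral>\<^sup>+y. indicator A y * indicator B (y - f x) \<partial>lborel \<partial>lborel)"
  proof (rule nn_integral_cong)
    fix x
    show "(\<integral>\<^sup>+y. ?I x y \<partial>lborel) = (\<integral>\<^sup>+y. indicator A y * indicator B (y - f x) \<partial>lborel)"
      using shift[of "\<lambda>y. indicator A y * indicator B (y - f x)" "f x"] by simp
  qed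
  also have "\<dots> = (\<integral>\<^sup>+y. \<integral>\<^sup>+x. indicator A y * indicator B (y - f x) \<partial>lborel \<partial>lborel)"
    by (rule lborel_pair.Fubini'[symmetric]) measurable
  also have "\<dots> = (\<integral>\<^sup>+y. indicator A y * emeasure lborel B \<partial>lborel)"
  proof (rule nn_integral_cong)
    fix y
    \<comment> \<open>In the other order, translation by \<open>g y\<close> reduces the argument of
      \<open>indicator B\<close> to \<open>- f x\<close>. Its norm is that of \<open>x\<close>, so
      the volume of \<open>B\<close> itself reappears.\<close>
    have *: "norm (y - f (g y + x)) = norm x" for x
      by (simp add: linear_add[OF lin] g orthogonal_transformation_norm[OF f])
    have "(\<integral>\<^sup>+x. indicator A y * indicator B (y - f x) \<partial>lborel)
        = indicator A y * (\<integral>\<^sup>+x. indicator B (y - f x) \<partial>lborel)"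
      by (subst nn_integral_cmult) auto
    also have "(\<integral>\<^sup>+x. indicator B (y - f x) \<partial>lborel) = (\<integral>\<^sup>+x. indicator B (y - f (g y + x)) \<partial>lborel)"
      by (rule shift[symmetric]) measurable
    also have "\<dots> = (\<integral>\<^sup>+x. indicator B x \<partial>lborel)"
      by (intro nn_integral_cong) (simp add: B_def indicator_def * del: norm_minus_commute)
    also have "\<dots> = emeasure lborel B"
      by simp
    finally show "(\<integral>\<^sup>+x. indicator A y * indicator B (y - f x) \<partial>lborel)
        = indicator A y * emeasure lborel B" .
  qed
  also have "\<dots> = emeasure lborel A * emeasure lborel B"
    by (simp add: nn_integral_multc)
  finally have "emeasure lborel (f -` A) * emeasure lborel B = emeasure lborel A * emeasure lborel B"
    using 1 by simp
  moreover have "emeasure lborel B \<noteq> 0" "emeasure lborel B \<noteq> \<infinity>"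
    unfolding B_def by (rule emeasure_unit_ball)+
  ultimately have "emeasure lborel (f -` A) = emeasure lborel A"
    by (metis infinity_ennreal_def mult_divide_eq_ennreal)
  then show "emeasure (distr lborel borel f) A = emeasure lborel A"
    by (simp add: emeasure_distr)
qed simp

section \<open>The uniform probability measure on the sphere\<close>

lemma sets_sphere_measure[measurable_cong, simp]: "sets sphere_measure = sets borel"
  and space_sphere_measure[simp]: "space sphere_measure = UNIV"
  by (simp_all add: sphere_measure_def)

lemma sgn_borel_measurable[measurable]:
  "(sgn :: 'a::euclidean_space \<Rightarrow> 'a) \<in> borel_measurable borel"
  unfolding sgn_div_norm[abs_def] by measurable

lemma prob_space_sphere_measure: "prob_space (sphere_measure :: (real^'n) measure)"
  unfolding sphere_measure_def
  by (intro prob_space.prob_space_distr prob_space_uniform_measure emeasure_unit_ball) simp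

text \<open>\<open>sgn\<close> yields unit vectors except at the origin, which is a null
  set.\<close>

lemma AE_sphere_measure_norm: "AE x in (sphere_measure :: (real^'n) measure). norm x = 1"
proof -
  have "AE x in (lborel :: (real^'n) measure). x \<noteq> 0"
    by (rule AE_lborel_singleton)
  then have "AE x in (lborel :: (real^'n) measure). x \<in> ball 0 1 \<longrightarrow> norm (sgn x) = 1"
    by (auto simp: norm_sgn)
  then have "AE x in uniform_measure lborel (ball (0::real^'n) 1). norm (sgn x) = 1"
    by (intro AE_uniform_measureI) auto
  then show ?thesis
    unfolding sphere_measure_def by (subst AE_distr_iff) auto
qed

text \<open>An orthogonal map preserves the ball and Lebesgue measure and, being linear and
  norm-preserving, commutes with \<open>sgn\<close>.\<close>

lemma distr_sphere_measure_orthogonal_transformation: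
  fixes f :: "real^'n \<Rightarrow> real^'n"
  assumes f: "orthogonal_transformation f"
  shows "distr sphere_measure borel f = sphere_measure"
proof -
  let ?U = "uniform_measure lborel (ball (0::real^'n) 1)"
  have lin: "linear f" by (rule orthogonal_transformation_linear[OF f])
  have f_meas[measurable]: "f \<in> borel_measurable borel"
    by (rule orthogonal_transformation_borel_measurable[OF f])
  have U: "distr ?U borel f = ?U"
  proof (rule measure_eqI)
    fix A assume "A \<in> sets (distr ?U borel f)"
    then have A[measurable]: "A \<in> sets borel" by simp
    have fA[measurable]: "f -` A \<in> sets borel"
      using measurable_sets[OF f_meas A] by simp
    have "emeasure (distr ?U borel f) A = emeasure lborel (ball 0 1 \<inter> f -` A) / emeasure lborel (ball (0::real^'n) 1)"
      by (simp add: emeasure_distr emeasure_uniform_measure)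
    also have "ball 0 1 \<inter> f -` A = f -` (ball 0 1 \<inter> A)"
      by (auto simp: orthogonal_transformation_norm[OF f])
    also have "emeasure lborel \<dots> = emeasure (distr lborel borel f) (ball 0 1 \<inter> A)"
      by (simp add: emeasure_distr)
    also have "\<dots> = emeasure lborel (ball 0 1 \<inter> A)"
      by (simp add: distr_lborel_orthogonal_transformation[OF f])
    finally show "emeasure (distr ?U borel f) A = emeasure ?U A"
      by (simp add: emeasure_uniform_measure)
  qed simp
  have comm: "f \<circ> sgn = sgn \<circ> f"
    by (auto simp: sgn_div_norm linear_scale[OF lin] orthogonal_transformation_norm[OF f])
  have "distr sphere_measure borel f = distr ?U borel (f \<circ> sgn)"
    unfolding sphere_measure_def by (rule distr_distr) auto
  also have "\<dots> = distr (distr ?U borel f) borel sgn"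
    unfolding comm by (rule distr_distr[symmetric]) auto
  finally show ?thesis
    by (simp add: U sphere_measure_def)
qed

text \<open>The \<open>m\<close>-th moment of one coordinate. \<open>SOME\<close> picks a coordinate
  (by rotation invariance all give the same value), and the \<open>itself\<close> argument fixes the
  dimension.\<close>

definition sphere_moment :: "'n::finite itself \<Rightarrow> nat \<Rightarrow> real" where
  "sphere_moment _ m = (\<integral>x. (x \<bullet> axis (SOME i::'n. True) 1) ^ m \<partial>sphere_measure)"

text \<open>Some orthogonal map takes \<open>norm w\<close> times the chosen axis to
  \<open>w\<close>; invariance of the measure reduces the integral to the moment along that
  axis.\<close>

lemma integral_sphere_power_inner:
  fixes w :: "real^'n"
  shows "(\<integral>x. (x \<bullet> w) ^ m \<partial>sphere_measure) = sphere_moment TYPE('n) m * norm w ^ m"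
proof -
  let ?e = "axis (SOME i::'n. True) (1::real)"
  obtain f where f: "orthogonal_transformation f" "f (norm w *\<^sub>R ?e) = w"
    by (rule orthogonal_transformation_exists[of "norm w *\<^sub>R ?e" w]) auto
  have [measurable]: "f \<in> borel_measurable borel"
    by (rule orthogonal_transformation_borel_measurable[OF f(1)])
  have "(\<integral>x. (x \<bullet> w) ^ m \<partial>sphere_measure) = (\<integral>x. (x \<bullet> w) ^ m \<partial>distr sphere_measure borel f)"
    by (simp add: distr_sphere_measure_orthogonal_transformation[OF f(1)])
  also have "\<dots> = (\<integral>x. (f x \<bullet> w) ^ m \<partial>sphere_measure)"
    by (subst integral_distr) auto
  also have "\<dots> = (\<integral>x. norm w ^ m * (x \<bullet> ?e) ^ m \<partial>sphere_measure)"
  proof (rule Bochner_Integration.integral_cong[OF refl])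
    fix x
    have "f x \<bullet> w = f x \<bullet> f (norm w *\<^sub>R ?e)" using f(2) by simp
    also have "\<dots> = norm w * (x \<bullet> ?e)"
      using f(1) unfolding orthogonal_transformation_def by simp
    finally show "(f x \<bullet> w) ^ m = norm w ^ m * (x \<bullet> ?e) ^ m"
      by (simp add: power_mult_distrib)
  qed
  finally show ?thesis
    by (simp add: sphere_moment_def mult.commute)
qed

text \<open>The negated axis has the same norm, hence the same moment, but for odd \<open>m\<close>
  the integrand changes sign.\<close>

lemma sphere_moment_odd: "odd m \<Longrightarrow> sphere_moment TYPE('n::finite) m = 0"
proof -
  assume m: "odd m"
  let ?e = "axis (SOME i::'n. True) (1::real)"
  have "sphere_moment TYPE('n) m = (\<integral>x. (x \<bullet> (- ?e)) ^ m \<partial>sphere_measure)"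
    unfolding integral_sphere_power_inner by simp
  also have "\<dots> = - sphere_moment TYPE('n) m"
    using m by (simp add: sphere_moment_def power_minus_odd)
  finally show ?thesis by simp
qed

lemma sphere_moment_even: "even m \<Longrightarrow> sphere_moment TYPE('n::finite) m \<ge> 0"
  unfolding sphere_moment_def by (intro integral_nonneg_AE AE_I2) (simp add: zero_le_even_power)

section \<open>Sign vectors and polarization\<close>

text \<open>Extensionality keeps the set finite; pointwise products have to be restricted to
  \<open>{..<m}\<close> to stay in it.\<close>

definition sign_vectors :: "nat \<Rightarrow> (nat \<Rightarrow> real) set" where
  "sign_vectors m = (\<Pi>\<^sub>E a\<in>{..<m}. {1, -1})"

lemma finite_sign_vectors: "finite (sign_vectors m)"
  by (auto simp: sign_vectors_def intro!: finite_PiE)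

lemma card_sign_vectors: "card (sign_vectors m) = 2 ^ m"
  by (simp add: sign_vectors_def card_PiE numeral_2_eq_2)

lemma sign_vectors_square: "\<epsilon> \<in> sign_vectors m \<Longrightarrow> a < m \<Longrightarrow> \<epsilon> a * \<epsilon> a = 1"
  by (auto simp: sign_vectors_def PiE_def Pi_def)

text \<open>Here \<open>\<psi>\<close> is a character of the group of sign vectors; the sum vanishes unless it is trivial.\<close>
lemma sum_sign_vectors_character:
  assumes mult: "\<And>\<epsilon> \<delta>. \<epsilon> \<in> sign_vectors m \<Longrightarrow> \<delta> \<in> sign_vectors m \<Longrightarrow>
      \<psi> (\<lambda>a\<in>{..<m}. \<epsilon> a * \<delta> a) = \<psi> \<epsilon> * (\<psi> \<delta> :: real)"
    and \<delta>: "\<delta> \<in> sign_vectors m"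
  shows "(\<Sum>\<epsilon>\<in>sign_vectors m. \<psi> \<epsilon>) = (\<Sum>\<epsilon>\<in>sign_vectors m. \<psi> \<epsilon>) * \<psi> \<delta>"
proof -
  let ?t = "\<lambda>\<epsilon>. \<lambda>a\<in>{..<m}. \<epsilon> a * \<delta> a"
  have t: "?t \<epsilon> \<in> sign_vectors m" if "\<epsilon> \<in> sign_vectors m" for \<epsilon>
    using that \<delta> unfolding sign_vectors_def PiE_def Pi_def by fastforce
  \<comment> \<open>Signs square to 1, so multiplication by \<open>\<delta>\<close> is an involution
    and serves as its own inverse in the reindexing.\<close>
  have tt: "?t (?t \<epsilon>) = \<epsilon>" if "\<epsilon> \<in> sign_vectors m" for \<epsilon>
  proof
    fix a show "?t (?t \<epsilon>) a = \<epsilon> a"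
      using that sign_vectors_square[OF \<delta>, of a]
      by (cases "a < m") (auto simp: mult.assoc sign_vectors_def PiE_def extensional_def)
  qed
  have "(\<Sum>\<epsilon>\<in>sign_vectors m. \<psi> \<epsilon>) = (\<Sum>\<epsilon>\<in>sign_vectors m. \<psi> (?t \<epsilon>))"
    by (rule sum.reindex_bij_witness[of _ ?t ?t]) (use t tt in auto)
  also have "\<dots> = (\<Sum>\<epsilon>\<in>sign_vectors m. \<psi> \<epsilon>) * \<psi> \<delta>"
    by (simp add: mult \<delta> sum_distrib_right)
  finally show ?thesis .
qed

text \<open>A negative value \<open>\<psi> \<delta>\<close> forces the sum \<open>S\<close> to
  vanish, by \<open>S * (1 - \<psi> \<delta>) = 0\<close>; without such a value every term is
  nonnegative.\<close>

lemma sum_sign_vectors_character_nonneg: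
  assumes mult: "\<And>\<epsilon> \<delta>. \<epsilon> \<in> sign_vectors m \<Longrightarrow> \<delta> \<in> sign_vectors m \<Longrightarrow>
      \<psi> (\<lambda>a\<in>{..<m}. \<epsilon> a * \<delta> a) = \<psi> \<epsilon> * (\<psi> \<delta> :: real)"
  shows "(\<Sum>\<epsilon>\<in>sign_vectors m. \<psi> \<epsilon>) \<ge> 0"
proof (cases "\<exists>\<delta>\<in>sign_vectors m. \<psi> \<delta> < 0")
  case True
  then obtain \<delta> where \<delta>: "\<delta> \<in> sign_vectors m" "\<psi> \<delta> < 0" by auto
  let ?S = "\<Sum>\<epsilon>\<in>sign_vectors m. \<psi> \<epsilon>"
  have "?S * (1 - \<psi> \<delta>) = ?S - ?S * \<psi> \<delta>"
    by (simp add: right_diff_distrib)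
  also have "\<dots> = 0"
    using sum_sign_vectors_character[where \<psi>=\<psi>, OF mult \<delta>(1)] by linarith
  finally have "?S * (1 - \<psi> \<delta>) = 0" .
  then show ?thesis using \<delta>(2) by auto
next
  case False
  then show ?thesis by (intro sum_nonneg) (auto simp: not_less)
qed

lemma power_sum_expand:
  fixes f :: "'a \<Rightarrow> 'b::comm_semiring_1"
  assumes "finite A"
  shows "(\<Sum>a\<in>A. f a) ^ k = (\<Sum>h\<in>{..<k} \<rightarrow>\<^sub>E A. \<Prod>l<k. f (h l))"
  using prod_sum_PiE[of "{..<k}" "\<lambda>_. A" "\<lambda>_. f"] assms by simp

text \<open>Expanding the power gives monomials indexed by maps \<open>h\<close> of the
  \<open>m\<close> indices into themselves, with character sums as coefficients. These vanish unless
  \<open>h\<close> is a bijection, in which case each of the \<open>2 ^ m\<close> sign vectors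
  contributes 1.\<close>

lemma polarization:
  obtains c :: real where "c > 0"
    "\<And>x :: nat \<Rightarrow> real. (\<Sum>\<epsilon>\<in>sign_vectors m. (\<Prod>a<m. \<epsilon> a) * (\<Sum>a<m. \<epsilon> a * x a) ^ m) = c * (\<Prod>a<m. x a)"
proof
  define H where "H = {..<m} \<rightarrow>\<^sub>E {..<m}"
  define Bj where "Bj = {h \<in> H. bij_betw h {..<m} {..<m}}"
  have finH: "finite H" by (auto simp: H_def intro!: finite_PiE)
  have finB: "finite Bj" "Bj \<subseteq> H" using finH by (auto simp: Bj_def)
  have "restrict id {..<m} \<in> Bj"
    by (auto simp: Bj_def H_def bij_betw_def inj_on_def)
  then have cB: "card Bj > 0" using finB by (auto simp: card_gt_0_iff)
  let ?X = "\<lambda>h \<epsilon>. (\<Prod>a<m. \<epsilon> a) * (\<Prod>l<m. \<epsilon> (h l)) :: real"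
  have coeff0: "(\<Sum>\<epsilon>\<in>sign_vectors m. ?X h \<epsilon>) = 0" if h: "h \<in> H - Bj" for h
  proof -
    have hm: "h l < m" if "l < m" for l using h that by (auto simp: H_def PiE_def Pi_def)
    have "h ` {..<m} \<noteq> {..<m}"
    proof
      assume "h ` {..<m} = {..<m}"
      then have "bij_betw h {..<m} {..<m}"
        by (simp add: bij_betw_def eq_card_imp_inj_on)
      with h show False by (simp add: Bj_def)
    qed
    \<comment> \<open>A non-bijective \<open>h\<close> misses some \<open>b\<close>. Flipping the
      sign at \<open>b\<close> alone affects only the first product of \<open>?X\<close>, so this
      character is nontrivial.\<close>
    then obtain b where b: "b < m" "b \<notin> h ` {..<m}" using hm by auto
    define \<delta> where "\<delta> = (\<lambda>a\<in>{..<m}. if a = b then -1 else 1 :: real)"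
    have \<delta>: "\<delta> \<in> sign_vectors m" by (auto simp: \<delta>_def sign_vectors_def)
    have X: "?X h \<delta> = -1"
    proof -
      have "(\<Prod>l<m. \<delta> (h l)) = 1"
        by (rule prod.neutral) (use b hm in \<open>auto simp: \<delta>_def\<close>)
      moreover have "(\<Prod>a<m. \<delta> a) = (\<Prod>a<m. if a = b then -1 else 1)"
        by (rule prod.cong) (auto simp: \<delta>_def)
      ultimately show ?thesis using b(1) by (simp add: prod.delta)
    qed
    have "(\<Sum>\<epsilon>\<in>sign_vectors m. ?X h \<epsilon>) = (\<Sum>\<epsilon>\<in>sign_vectors m. ?X h \<epsilon>) * ?X h \<delta>"
      by (rule sum_sign_vectors_character[OF _ \<delta>]) (simp add: hm prod.distrib)
    then show ?thesis unfolding X by linarith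
  qed
  have coeff1: "(\<Sum>\<epsilon>\<in>sign_vectors m. ?X h \<epsilon>) = 2 ^ m" if h: "h \<in> Bj" for h
  proof -
    have "?X h \<epsilon> = 1" if \<epsilon>: "\<epsilon> \<in> sign_vectors m" for \<epsilon>
    proof -
      have "(\<Prod>l<m. \<epsilon> (h l)) = (\<Prod>a<m. \<epsilon> a)"
        using h by (intro prod.reindex_bij_betw) (simp add: Bj_def)
      then have "?X h \<epsilon> = (\<Prod>a<m. \<epsilon> a * \<epsilon> a)" by (simp add: prod.distrib)
      also have "\<dots> = 1" using sign_vectors_square[OF \<epsilon>] by (intro prod.neutral) auto
      finally show ?thesis .
    qed
    then show ?thesis by (simp add: card_sign_vectors)
  qed
  show "2 ^ m * real (card Bj) > 0" using cB by simp
  fix x :: "nat \<Rightarrow> real"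
  have "(\<Sum>\<epsilon>\<in>sign_vectors m. (\<Prod>a<m. \<epsilon> a) * (\<Sum>a<m. \<epsilon> a * x a) ^ m)
      = (\<Sum>\<epsilon>\<in>sign_vectors m. \<Sum>h\<in>H. ?X h \<epsilon> * (\<Prod>l<m. x (h l)))"
    by (simp add: power_sum_expand H_def sum_distrib_left prod.distrib mult_ac)
  also have "\<dots> = (\<Sum>h\<in>H. (\<Sum>\<epsilon>\<in>sign_vectors m. ?X h \<epsilon>) * (\<Prod>l<m. x (h l)))"
    by (subst sum.swap) (simp add: sum_distrib_right)
  also have "\<dots> = (\<Sum>h\<in>Bj. (\<Sum>\<epsilon>\<in>sign_vectors m. ?X h \<epsilon>) * (\<Prod>l<m. x (h l)))"
    by (rule sum.mono_neutral_right) (use finH finB coeff0 in auto)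
  also have "\<dots> = (\<Sum>h\<in>Bj. 2 ^ m * (\<Prod>a<m. x a))"
  proof (rule sum.cong[OF refl])
    fix h assume h: "h \<in> Bj"
    have "(\<Prod>l<m. x (h l)) = (\<Prod>a<m. x a)"
      using h by (intro prod.reindex_bij_betw) (simp add: Bj_def)
    then show "(\<Sum>\<epsilon>\<in>sign_vectors m. ?X h \<epsilon>) * (\<Prod>l<m. x (h l)) = 2 ^ m * (\<Prod>a<m. x a)"
      by (simp only: coeff1[OF h])
  qed
  finally show "(\<Sum>\<epsilon>\<in>sign_vectors m. (\<Prod>a<m. \<epsilon> a) * (\<Sum>a<m. \<epsilon> a * x a) ^ m)
      = 2 ^ m * real (card Bj) * (\<Prod>a<m. x a)" by simp
qed

section \<open>The cone generated by products of inner products\<close>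

text \<open>Equal indices are allowed because identifying vertices creates factors
  \<open>\<sigma> i \<bullet> \<sigma> i\<close>, and the constant 0 because odd moments
  vanish.\<close>

inductive_set gram_cone :: "'i set \<Rightarrow> (('i \<Rightarrow> 'v::euclidean_space) \<Rightarrow> real) set" for I where
  const: "c \<ge> 0 \<Longrightarrow> (\<lambda>_. c) \<in> gram_cone I"
| add: "f \<in> gram_cone I \<Longrightarrow> g \<in> gram_cone I \<Longrightarrow> (\<lambda>\<sigma>. f \<sigma> + g \<sigma>) \<in> gram_cone I"
| inner: "i \<in> I \<Longrightarrow> j \<in> I \<Longrightarrow> f \<in> gram_cone I \<Longrightarrow> (\<lambda>\<sigma>. (\<sigma> i \<bullet> \<sigma> j) * f \<sigma>) \<in> gram_cone I"

lemma gram_cone_scale: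
  assumes "c \<ge> 0" "f \<in> gram_cone I"
  shows "(\<lambda>\<sigma>. c * f \<sigma>) \<in> gram_cone I"
  using assms(2)
proof induction
  case (const d) then show ?case using assms(1) by (intro gram_cone.const) simp
next
  case (add f g) then show ?case by (simp add: distrib_left gram_cone.add)
next
  case (inner i j f) then show ?case
    using gram_cone.inner[of i I j "\<lambda>\<sigma>. c * f \<sigma>"] by (simp add: mult.left_commute)
qed

lemma gram_cone_mult:
  assumes "f \<in> gram_cone I" "g \<in> gram_cone I"
  shows "(\<lambda>\<sigma>. f \<sigma> * g \<sigma>) \<in> gram_cone I"
  using assms(1)
proof induction
  case (const d) then show ?case using assms(2) by (rule gram_cone_scale)
next
  case (add f h) then show ?case by (simp add: distrib_right gram_cone.add)
next
  case (inner i j f) then show ?case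
    using gram_cone.inner[of i I j "\<lambda>\<sigma>. f \<sigma> * g \<sigma>"] by (simp add: mult.assoc)
qed

lemma gram_cone_sum:
  assumes "\<And>k. k \<in> K \<Longrightarrow> f k \<in> gram_cone I"
  shows "(\<lambda>\<sigma>. \<Sum>k\<in>K. f k \<sigma>) \<in> gram_cone I"
  using assms
  by (induction K rule: infinite_finite_induct) (auto intro: gram_cone.add gram_cone.const[of 0, simplified])

lemma gram_cone_prod:
  assumes "\<And>k. k \<in> K \<Longrightarrow> f k \<in> gram_cone I"
  shows "(\<lambda>\<sigma>. \<Prod>k\<in>K. f k \<sigma>) \<in> gram_cone I"
  using assms
  by (induction K rule: infinite_finite_induct) (auto intro: gram_cone_mult gram_cone.const[of 1, simplified])

lemma gram_cone_inner: "i \<in> I \<Longrightarrow> j \<in> I \<Longrightarrow> (\<lambda>\<sigma>. \<sigma> i \<bullet> \<sigma> j) \<in> gram_cone I"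
  using gram_cone.inner[OF _ _ gram_cone.const[of 1]] by simp

lemma gram_cone_power: "f \<in> gram_cone I \<Longrightarrow> (\<lambda>\<sigma>. f \<sigma> ^ k) \<in> gram_cone I"
  using gram_cone_prod[of "{..<k}" "\<lambda>_. f"] by simp

text \<open>\<open>r\<close> may be non-injective, so this covers both renaming vertices and
  identifying them.\<close>

lemma gram_cone_reindex:
  assumes "f \<in> gram_cone I" "r ` I \<subseteq> J"
  shows "(\<lambda>\<sigma>. f (\<lambda>i. \<sigma> (r i))) \<in> gram_cone J"
  using assms(1) by induction (use assms(2) in \<open>auto intro!: gram_cone.intros\<close>)

lemma gram_cone_merge:
  assumes "f \<in> gram_cone (insert i I)" "j \<in> I"
  shows "(\<lambda>\<sigma>. f (\<sigma>(i := \<sigma> j))) \<in> gram_cone I"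
proof -
  have "(\<lambda>\<sigma>. f (\<sigma>(i := \<sigma> j))) = (\<lambda>\<sigma>. f (\<lambda>k. \<sigma> (if k = i then j else k)))"
    by (intro ext arg_cong[where f=f]) auto
  also have "\<dots> \<in> gram_cone I"
    by (rule gram_cone_reindex[OF assms(1)]) (use assms(2) in auto)
  finally show ?thesis .
qed

text \<open>Allows entries outside \<open>I\<close> to be changed freely, for instance when
  extensional families are compared with reindexed or merged ones.\<close>

lemma gram_cone_cong:
  assumes "f \<in> gram_cone I" "\<And>i. i \<in> I \<Longrightarrow> \<sigma> i = \<tau> i"
  shows "f \<sigma> = f \<tau>"
  using assms(1) by induction (auto simp: assms(2))

lemma gram_cone_bounded:
  assumes "f \<in> gram_cone I"
  shows "\<exists>B. \<forall>\<sigma>. (\<forall>i\<in>I. norm (\<sigma> i) \<le> R) \<longrightarrow> \<bar>f \<sigma>\<bar> \<le> B"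
  using assms
proof induction
  case (const c) then show ?case by auto
next
  case (add f g)
  then obtain B C where "\<forall>\<sigma>. (\<forall>i\<in>I. norm (\<sigma> i) \<le> R) \<longrightarrow> \<bar>f \<sigma>\<bar> \<le> B"
    "\<forall>\<sigma>. (\<forall>i\<in>I. norm (\<sigma> i) \<le> R) \<longrightarrow> \<bar>g \<sigma>\<bar> \<le> C" by blast
  then show ?case by (intro exI[of _ "B + C"]) (fastforce intro: order_trans[OF abs_triangle_ineq])
next
  case (inner i j f)
  then obtain B where B: "\<And>\<sigma>. (\<forall>i\<in>I. norm (\<sigma> i) \<le> R) \<Longrightarrow> \<bar>f \<sigma>\<bar> \<le> B" by blast
  have "\<bar>(\<sigma> i \<bullet> \<sigma> j) * f \<sigma>\<bar> \<le> R * R * B" if \<sigma>: "\<forall>i\<in>I. norm (\<sigma> i) \<le> R" for \<sigma>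
  proof -
    have R: "0 \<le> R" using \<sigma> inner(1) norm_ge_zero order_trans by blast
    have "\<bar>\<sigma> i \<bullet> \<sigma> j\<bar> \<le> norm (\<sigma> i) * norm (\<sigma> j)" by (rule Cauchy_Schwarz_ineq2)
    also have "\<dots> \<le> R * R" using \<sigma> inner(1,2) R by (intro mult_mono) auto
    finally show ?thesis using B[OF \<sigma>] R unfolding abs_mult by (intro mult_mono) auto
  qed
  then show ?case by blast
qed

lemma gram_cone_measurable:
  assumes "f \<in> gram_cone I"
  shows "f \<in> borel_measurable (PiM I (\<lambda>_. borel))"
  using assms
proof induction
  case (inner i j f)
  then show ?case
    by (intro borel_measurable_times borel_measurable_inner measurable_component_singleton) auto
qed auto

lemma gram_cone_update_measurable:
  assumes "f \<in> gram_cone I"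
  shows "(\<lambda>x. f (\<sigma>(i := x))) \<in> borel_measurable borel"
  using assms
proof induction
  case (inner j k f)
  note [measurable] = inner(4)
  have [measurable]: "(\<lambda>x. (\<sigma>(i := x)) j) \<in> borel_measurable borel" for j
    by (cases "j = i") auto
  show ?case by measurable
qed auto

lemma gram_cone_nonneg_diagonal:
  assumes "f \<in> gram_cone I"
  shows "f (\<lambda>_. u) \<ge> 0"
  using assms by induction auto

text \<open>Cauchy-Schwarz bounds each inner product by 1, its value on the diagonal, and the
  coefficients are nonnegative.\<close>

lemma gram_cone_le_diagonal:
  assumes "f \<in> gram_cone I" "\<And>i. i \<in> I \<Longrightarrow> norm (\<sigma> i) = 1" "norm u = 1"
  shows "\<bar>f \<sigma>\<bar> \<le> f (\<lambda>_. u)"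
  using assms(1)
proof induction
  case (inner i j f)
  have "\<bar>\<sigma> i \<bullet> \<sigma> j\<bar> \<le> 1"
    using Cauchy_Schwarz_ineq2[of "\<sigma> i" "\<sigma> j"] assms(2) inner by simp
  then have "\<bar>\<sigma> i \<bullet> \<sigma> j\<bar> * \<bar>f \<sigma>\<bar> \<le> 1 * f (\<lambda>_. u)"
    using inner by (intro mult_mono) auto
  then show ?case using assms(3) by (simp add: abs_mult norm_eq_1)
qed auto

lemma gram_cone_diagonal_eq:
  assumes "f \<in> gram_cone I" "norm u = 1" "norm v = 1"
  shows "f (\<lambda>_. u) = f (\<lambda>_. v)"
  using assms(1) by induction (use assms(2,3) in \<open>auto simp: norm_eq_1\<close>)

section \<open>Integrating out a vertex\<close>

interpretation sphere: prob_space "sphere_measure :: (real^'n) measure"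
  by (rule prob_space_sphere_measure)

interpretation sphere_product: product_sigma_finite "\<lambda>_ :: 'i. (sphere_measure :: (real^'n) measure)"
  by standard

lemma integrable_sphere_power_inner:
  "integrable sphere_measure (\<lambda>x :: real^'n. (x \<bullet> w) ^ m)"
proof (rule sphere.integrable_const_bound)
  show "AE x in sphere_measure. norm ((x \<bullet> w) ^ m) \<le> norm w ^ m"
    using AE_sphere_measure_norm
  proof eventually_elim
    fix x :: "real^'n" assume "norm x = 1"
    then have "\<bar>x \<bullet> w\<bar> \<le> norm w" using Cauchy_Schwarz_ineq2[of x w] by simp
    then show "norm ((x \<bullet> w) ^ m) \<le> norm w ^ m" by (simp add: power_abs power_mono)
  qed
qed measurable

text \<open>The polarization identity reduces the integral to \<open>m\<close>-th powers of \<open>norm w\<close> with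
  \<open>w = (\<Sum>a<m. \<epsilon> a *\<^sub>R \<sigma> (q a))\<close>. For even \<open>m\<close> these are polynomials in the inner products whose
  coefficients become, after summation over \<open>\<epsilon>\<close>, character sums, hence nonnegative.\<close>
lemma gram_cone_integral_prod_inner:
  fixes q :: "nat \<Rightarrow> 'i"
  assumes q: "\<And>a. a < m \<Longrightarrow> q a \<in> I"
  shows "(\<lambda>\<sigma> :: 'i \<Rightarrow> real^'n. \<integral>x. (\<Prod>a<m. x \<bullet> \<sigma> (q a)) \<partial>sphere_measure) \<in> gram_cone I"
proof -
  obtain c where c: "c > 0" and pol: "\<And>x :: nat \<Rightarrow> real.
      (\<Sum>\<epsilon>\<in>sign_vectors m. (\<Prod>a<m. \<epsilon> a) * (\<Sum>a<m. \<epsilon> a * x a) ^ m) = c * (\<Prod>a<m. x a)"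
    using polarization[of m] by blast
  define w where "w \<sigma> \<epsilon> = (\<Sum>a<m. \<epsilon> a *\<^sub>R \<sigma> (q a))" for \<sigma> :: "'i \<Rightarrow> real^'n" and \<epsilon>
  have int: "c * (\<integral>x. (\<Prod>a<m. x \<bullet> \<sigma> (q a)) \<partial>sphere_measure)
      = sphere_moment TYPE('n) m * (\<Sum>\<epsilon>\<in>sign_vectors m. (\<Prod>a<m. \<epsilon> a) * norm (w \<sigma> \<epsilon>) ^ m)"
    for \<sigma> :: "'i \<Rightarrow> real^'n"
  proof -
    have "c * (\<integral>x. (\<Prod>a<m. x \<bullet> \<sigma> (q a)) \<partial>sphere_measure)
        = (\<integral>x. (\<Sum>\<epsilon>\<in>sign_vectors m. (\<Prod>a<m. \<epsilon> a) * (x \<bullet> w \<sigma> \<epsilon>) ^ m) \<partial>sphere_measure)"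
      by (simp add: pol[symmetric] w_def inner_sum_right flip: integral_mult_right_zero)
    also have "\<dots> = (\<Sum>\<epsilon>\<in>sign_vectors m. (\<Prod>a<m. \<epsilon> a) * (\<integral>x. (x \<bullet> w \<sigma> \<epsilon>) ^ m \<partial>sphere_measure))"
      by (subst Bochner_Integration.integral_sum) (auto intro: integrable_sphere_power_inner)
    finally show ?thesis
      by (simp add: integral_sphere_power_inner sum_distrib_left mult_ac)
  qed
  show ?thesis
  proof (cases "even m")
    case False
    then have "(\<integral>x. (\<Prod>a<m. x \<bullet> \<sigma> (q a)) \<partial>sphere_measure) = 0" for \<sigma> :: "'i \<Rightarrow> real^'n"
      using int[of \<sigma>] c by (simp add: sphere_moment_odd)
    then show ?thesis by (simp add: gram_cone.const)
  next
    case True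
    then obtain k where k: "m = 2 * k" by (rule evenE)
    \<comment> \<open>The \<open>m\<close>-th power of the norm is the \<open>k\<close>-th power of
      a double sum over pairs of indices; \<open>h\<close> chooses one pair for each of the
      \<open>k\<close> factors.\<close>
    define H where "H = {..<k} \<rightarrow>\<^sub>E ({..<m} \<times> {..<m})"
    let ?X = "\<lambda>h \<epsilon>. (\<Prod>a<m. \<epsilon> a) * (\<Prod>l<k. \<epsilon> (fst (h l)) * \<epsilon> (snd (h l))) :: real"
    let ?M = "\<lambda>h \<sigma>. \<Prod>l<k. \<sigma> (q (fst (h l))) \<bullet> \<sigma> (q (snd (h l)))"
    have Hm: "fst (h l) < m" "snd (h l) < m" if "h \<in> H" "l < k" for h l
      using that by (auto simp: H_def PiE_def Pi_def mem_Times_iff)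
    have norm_w: "norm (w \<sigma> \<epsilon>) ^ m
        = (\<Sum>h\<in>H. (\<Prod>l<k. \<epsilon> (fst (h l)) * \<epsilon> (snd (h l))) * ?M h \<sigma>)" for \<sigma> \<epsilon>
    proof -
      have "norm (w \<sigma> \<epsilon>) ^ m = (w \<sigma> \<epsilon> \<bullet> w \<sigma> \<epsilon>) ^ k"
        by (simp add: k power_mult power2_norm_eq_inner)
      also have "w \<sigma> \<epsilon> \<bullet> w \<sigma> \<epsilon> = (\<Sum>p\<in>{..<m}\<times>{..<m}. \<epsilon> (fst p) * \<epsilon> (snd p) * (\<sigma> (q (fst p)) \<bullet> \<sigma> (q (snd p))))"
        by (simp only: w_def inner_sum_left inner_sum_right)
          (subst sum.swap, simp add: sum.cartesian_product split_def mult_ac)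
      finally show ?thesis
        by (simp add: power_sum_expand H_def prod.distrib)
    qed
    have eq: "(\<integral>x. (\<Prod>a<m. x \<bullet> \<sigma> (q a)) \<partial>sphere_measure)
        = sphere_moment TYPE('n) m / c * (\<Sum>h\<in>H. (\<Sum>\<epsilon>\<in>sign_vectors m. ?X h \<epsilon>) * ?M h \<sigma>)"
      for \<sigma> :: "'i \<Rightarrow> real^'n"
    proof -
      have "(\<Sum>\<epsilon>\<in>sign_vectors m. (\<Prod>a<m. \<epsilon> a) * norm (w \<sigma> \<epsilon>) ^ m)
          = (\<Sum>\<epsilon>\<in>sign_vectors m. \<Sum>h\<in>H. ?X h \<epsilon> * ?M h \<sigma>)"
        by (simp add: norm_w sum_distrib_left mult.assoc)
      also have "\<dots> = (\<Sum>h\<in>H. (\<Sum>\<epsilon>\<in>sign_vectors m. ?X h \<epsilon>) * ?M h \<sigma>)"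
        by (subst sum.swap) (simp add: sum_distrib_right)
      finally have "c * (\<integral>x. (\<Prod>a<m. x \<bullet> \<sigma> (q a)) \<partial>sphere_measure)
          = sphere_moment TYPE('n) m * (\<Sum>h\<in>H. (\<Sum>\<epsilon>\<in>sign_vectors m. ?X h \<epsilon>) * ?M h \<sigma>)"
        by (simp only: int)
      then show ?thesis
        using c by (simp only: divide_inverse) (simp add: field_simps)
    qed
    have coeff: "(\<Sum>\<epsilon>\<in>sign_vectors m. ?X h \<epsilon>) \<ge> 0" if "h \<in> H" for h
      by (rule sum_sign_vectors_character_nonneg) (simp add: Hm[OF that] prod.distrib mult_ac)
    show ?thesis
      unfolding eq
      by (intro gram_cone_sum gram_cone_scale gram_cone_prod gram_cone_inner divide_nonneg_pos
          coeff c sphere_moment_even[OF True] q Hm) auto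
  qed
qed

lemma AE_PiM_sphere_measure_norm:
  assumes "finite I"
  shows "AE \<sigma> in PiM I (\<lambda>_. sphere_measure :: (real^'n) measure). \<forall>i\<in>I. norm (\<sigma> i) = 1"
  using assms
  by (intro AE_finite_allI AE_PiM_component prob_space_sphere_measure AE_sphere_measure_norm)

lemma gram_cone_integrable:
  fixes f :: "('i \<Rightarrow> real^'n) \<Rightarrow> real"
  assumes "finite I" "f \<in> gram_cone I"
  shows "integrable (PiM I (\<lambda>_. sphere_measure)) f"
proof -
  interpret P: prob_space "PiM I (\<lambda>_. sphere_measure :: (real^'n) measure)"
    by (intro prob_space_PiM prob_space_sphere_measure)
  obtain B where B: "\<And>\<sigma>. (\<forall>i\<in>I. norm (\<sigma> i) \<le> 1) \<Longrightarrow> \<bar>f \<sigma>\<bar> \<le> B"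
    using gram_cone_bounded[OF assms(2), of 1] by blast
  show ?thesis
  proof (rule P.integrable_const_bound)
    show "AE \<sigma> in PiM I (\<lambda>_. sphere_measure). norm (f \<sigma>) \<le> B"
      using AE_PiM_sphere_measure_norm[OF assms(1)] by eventually_elim (simp add: B)
    have "sets (PiM I (\<lambda>_. sphere_measure :: (real^'n) measure)) = sets (PiM I (\<lambda>_. borel))"
      by (intro sets_PiM_cong) auto
    then show "f \<in> borel_measurable (PiM I (\<lambda>_. sphere_measure))"
      using gram_cone_measurable[OF assms(2)] measurable_cong_sets by blast
  qed
qed

text \<open>The fixed vectors \<open>\<sigma>\<close> need not be unit vectors, so the integrand is
  bounded on balls whose radius \<open>R\<close> depends on \<open>\<sigma>\<close>.\<close>

lemma gram_cone_update_integrable: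
  fixes f :: "('i \<Rightarrow> real^'n) \<Rightarrow> real"
  assumes "finite I" "f \<in> gram_cone I"
  shows "integrable sphere_measure (\<lambda>x. f (\<sigma>(i := x)))"
proof -
  define R where "R = Max (insert 1 ((\<lambda>i. norm (\<sigma> i)) ` I))"
  have R: "1 \<le> R" "\<And>i. i \<in> I \<Longrightarrow> norm (\<sigma> i) \<le> R" using assms(1) by (auto simp: R_def)
  obtain B where B: "\<And>\<sigma>. (\<forall>i\<in>I. norm (\<sigma> i) \<le> R) \<Longrightarrow> \<bar>f \<sigma>\<bar> \<le> B"
    using gram_cone_bounded[OF assms(2), of R] by blast
  show ?thesis
  proof (rule sphere.integrable_const_bound)
    show "AE x in sphere_measure. norm (f (\<sigma>(i := x))) \<le> B"
      using AE_sphere_measure_norm by eventually_elim (simp add: B R)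
  qed (use gram_cone_update_measurable[OF assms(2)] in simp)
qed

text \<open>The additional factor of inner products with \<open>x\<close> makes the induction go through: it absorbs
  the factors of \<open>f\<close> in which the integrated vertex \<open>i\<close> occurs.\<close>
lemma gram_cone_integral_update_aux:
  fixes f :: "('i \<Rightarrow> real^'n) \<Rightarrow> real" and q :: "nat \<Rightarrow> 'i"
  assumes I: "finite I" "i \<notin> I" and f: "f \<in> gram_cone (insert i I)"
    and q: "\<And>a. a < m \<Longrightarrow> q a \<in> I"
  shows "(\<lambda>\<sigma>. \<integral>x. f (\<sigma>(i := x)) * (\<Prod>a<m. x \<bullet> \<sigma> (q a)) \<partial>sphere_measure) \<in> gram_cone I"
  using f q
proof (induction arbitrary: m q)
  case (const c)
  then show ?case by (simp add: gram_cone_scale gram_cone_integral_prod_inner)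
next
  case (add f g)
  have int: "integrable sphere_measure (\<lambda>x. h (\<sigma>(i := x)) * (\<Prod>a<m. x \<bullet> \<sigma> (q a)))"
    if h: "h \<in> gram_cone (insert i I)" for h and \<sigma> :: "'i \<Rightarrow> real^'n"
  proof -
    \<comment> \<open>Reading \<open>x\<close> as vertex \<open>i\<close> makes the integrand an
      update of a cone element; the vectors \<open>\<sigma> (q a)\<close> are unaffected, as
      \<open>q a\<close> lies in \<open>I\<close> and \<open>i\<close> does not.\<close>
    have "(\<lambda>\<sigma>. h \<sigma> * (\<Prod>a<m. \<sigma> i \<bullet> \<sigma> (q a))) \<in> gram_cone (insert i I)"
      using add.prems by (intro gram_cone_mult h gram_cone_prod gram_cone_inner) auto
    from gram_cone_update_integrable[OF _ this, of \<sigma> i]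
    have "integrable sphere_measure (\<lambda>x. h (\<sigma>(i := x)) * (\<Prod>a<m. x \<bullet> (\<sigma>(i := x)) (q a)))"
      using I by simp
    also have "(\<lambda>x. h (\<sigma>(i := x)) * (\<Prod>a<m. x \<bullet> (\<sigma>(i := x)) (q a))) = (\<lambda>x. h (\<sigma>(i := x)) * (\<Prod>a<m. x \<bullet> \<sigma> (q a)))"
      using add.prems I(2) by (intro ext arg_cong2[where f="(*)"] refl prod.cong) (metis fun_upd_other lessThan_iff)
    finally show ?thesis .
  qed
  show ?case
    unfolding distrib_right Bochner_Integration.integral_add[OF int[OF add.hyps(1)] int[OF add.hyps(2)]]
    by (intro gram_cone.add add.IH add.prems)
next
  case (inner j k f)
  have one: "(\<lambda>\<sigma>. \<integral>x. (x \<bullet> \<sigma> b) * f (\<sigma>(i := x)) * (\<Prod>a<m. x \<bullet> \<sigma> (q a)) \<partial>sphere_measure) \<in> gram_cone I"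
    if b: "b \<in> I" for b
  proof -
    \<comment> \<open>The new factor \<open>x \<bullet> \<sigma> b\<close> is appended to the
      product as its entry with index \<open>m\<close>.\<close>
    have "(\<lambda>\<sigma>. \<integral>x. f (\<sigma>(i := x)) * (\<Prod>a<Suc m. x \<bullet> \<sigma> ((q(m := b)) a)) \<partial>sphere_measure) \<in> gram_cone I"
      using b inner.prems by (intro inner.IH) (auto simp: less_Suc_eq)
    then show ?thesis by (simp add: mult_ac)
  qed
  consider "j = i" "k = i" | "j = i" "k \<in> I" "k \<noteq> i" | "k = i" "j \<in> I" "j \<noteq> i"
    | "j \<in> I" "k \<in> I" "j \<noteq> i" "k \<noteq> i"
    using inner.hyps I(2) by auto
  then show ?case
  proof cases
    case 1
    \<comment> \<open>A factor \<open>x \<bullet> x\<close> drops out because it equals 1 almost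
      everywhere.\<close>
    have eq: "(\<integral>x. (x \<bullet> x) * f (\<sigma>(i := x)) * (\<Prod>a<m. x \<bullet> \<sigma> (q a)) \<partial>sphere_measure)
        = (\<integral>x. f (\<sigma>(i := x)) * (\<Prod>a<m. x \<bullet> \<sigma> (q a)) \<partial>sphere_measure)" for \<sigma>
    proof (rule integral_cong_AE)
      note [measurable] = gram_cone_update_measurable[OF inner.hyps(3), of \<sigma> i]
      show "(\<lambda>x. (x \<bullet> x) * f (\<sigma>(i := x)) * (\<Prod>a<m. x \<bullet> \<sigma> (q a))) \<in> borel_measurable sphere_measure"
        "(\<lambda>x. f (\<sigma>(i := x)) * (\<Prod>a<m. x \<bullet> \<sigma> (q a))) \<in> borel_measurable sphere_measure"
        by measurable
      show "AE x in sphere_measure. (x \<bullet> x) * f (\<sigma>(i := x)) * (\<Prod>a<m. x \<bullet> \<sigma> (q a))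
          = f (\<sigma>(i := x)) * (\<Prod>a<m. x \<bullet> \<sigma> (q a))"
        using AE_sphere_measure_norm by eventually_elim (simp add: norm_eq_1)
    qed
    show ?thesis
      using inner.IH[of m q, OF inner.prems] by (simp only: 1 fun_upd_same eq)
  next
    case 2 with one[of k] show ?thesis by (simp del: fun_upd_apply add: fun_upd_same fun_upd_other)
  next
    case 3 with one[of j] show ?thesis
      by (simp del: fun_upd_apply add: fun_upd_same fun_upd_other inner_commute[of "\<sigma> j" for \<sigma>])
  next
    case 4
    have "(\<lambda>\<sigma>. (\<sigma> j \<bullet> \<sigma> k) * (\<integral>x. f (\<sigma>(i := x)) * (\<Prod>a<m. x \<bullet> \<sigma> (q a)) \<partial>sphere_measure)) \<in> gram_cone I"
      using 4 by (intro gram_cone.inner inner.IH inner.prems)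
    with 4 show ?thesis by (simp del: fun_upd_apply add: fun_upd_other mult.assoc)
  qed
qed

lemma gram_cone_integral_update:
  fixes f :: "('i \<Rightarrow> real^'n) \<Rightarrow> real"
  assumes "finite I" "i \<notin> I" "f \<in> gram_cone (insert i I)"
  shows "(\<lambda>\<sigma>. \<integral>x. f (\<sigma>(i := x)) \<partial>sphere_measure) \<in> gram_cone I"
  \<comment> \<open>For \<open>m = 0\<close> the product is empty and the condition on
    \<open>q\<close> is vacuous.\<close>
  using gram_cone_integral_update_aux[OF assms, where m=0 and q="\<lambda>_. i"] by simp

section \<open>Positivity of integrals and merging of vertices\<close>

lemma gram_cone_integral_insert:
  fixes f :: "('i \<Rightarrow> real^'n) \<Rightarrow> real"
  assumes "finite I" "i \<notin> I" "f \<in> gram_cone (insert i I)"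
  shows "integral\<^sup>L (PiM (insert i I) (\<lambda>_. sphere_measure)) f
      = (\<integral>\<sigma>. (\<integral>x. f (\<sigma>(i := x)) \<partial>sphere_measure) \<partial>PiM I (\<lambda>_. sphere_measure))"
  using assms by (intro sphere_product.product_integral_insert gram_cone_integrable) auto

text \<open>The vertices are integrated out one at a time; each partial integral stays in the
  cone.\<close>

lemma gram_cone_integral_nonneg:
  fixes f :: "('i \<Rightarrow> real^'n) \<Rightarrow> real"
  assumes "finite I" "f \<in> gram_cone I"
  shows "integral\<^sup>L (PiM I (\<lambda>_. sphere_measure)) f \<ge> 0"
  using assms
proof (induction I arbitrary: f rule: finite_induct)
  case empty
  \<comment> \<open>The empty product measure sits at the single point
    \<open>\<lambda>_. undefined\<close>, a constant family, where cone elements are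
    nonnegative.\<close>
  have "f (\<lambda>_. undefined) \<ge> 0" using empty by (rule gram_cone_nonneg_diagonal)
  then show ?case by (simp add: PiM_empty lebesgue_integral_count_space_finite)
next
  case (insert i I)
  then show ?case
    by (simp add: gram_cone_integral_insert gram_cone_integral_update)
qed

text \<open>Integrating out all vertices other than \<open>i\<close> and \<open>j\<close> leaves an element of the cone in two unit vectors, which is largest where they coincide.\<close>
lemma gram_cone_integral_merge_le:
  fixes f :: "('i \<Rightarrow> real^'n) \<Rightarrow> real"
  assumes "finite J" "i \<notin> insert j J" "j \<notin> J" "f \<in> gram_cone (insert i (insert j J))"
  shows "integral\<^sup>L (PiM (insert i (insert j J)) (\<lambda>_. sphere_measure)) f
      \<le> (\<integral>\<sigma>. f (\<sigma>(i := \<sigma> j)) \<partial>PiM (insert j J) (\<lambda>_. sphere_measure))"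
  using assms
proof (induction J arbitrary: f rule: finite_induct)
  case empty
  let ?u = "axis (SOME i::'n. True) (1::real)"
  let ?P = "\<lambda>I. PiM I (\<lambda>_::'i. sphere_measure :: (real^'n) measure)"
  have fin: "finite {i, j}" "finite {j}" by simp_all
  interpret Pij: prob_space "?P {i, j}" by (intro prob_space_PiM prob_space_sphere_measure)
  interpret Pj: prob_space "?P {j}" by (intro prob_space_PiM prob_space_sphere_measure)
  \<comment> \<open>With only two vertices, the diagonal value at any unit vector bounds
    \<open>f\<close> almost everywhere, and merging \<open>i\<close> into \<open>j\<close> attains
    it almost everywhere.\<close>
  have "integral\<^sup>L (?P {i, j}) f \<le> integral\<^sup>L (?P {i, j}) (\<lambda>_. f (\<lambda>_. ?u))"
  proof (rule integral_mono_AE)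
    show "AE \<sigma> in ?P {i, j}. f \<sigma> \<le> f (\<lambda>_. ?u)"
      using AE_PiM_sphere_measure_norm[OF fin(1)]
    proof eventually_elim
      case (elim \<sigma>)
      then have "\<bar>f \<sigma>\<bar> \<le> f (\<lambda>_. ?u)"
        by (intro gram_cone_le_diagonal[OF empty.prems(3)]) auto
      then show ?case by simp
    qed
  qed (use empty in \<open>auto intro!: gram_cone_integrable\<close>)
  also have "\<dots> = (\<integral>\<sigma>. f (\<lambda>_. ?u) \<partial>?P {j})"
    by (simp add: Pij.prob_space Pj.prob_space)
  also have "\<dots> = (\<integral>\<sigma>. f (\<sigma>(i := \<sigma> j)) \<partial>?P {j})"
  proof (rule integral_cong_AE)
    have "(\<lambda>\<sigma>. f (\<sigma>(i := \<sigma> j))) \<in> gram_cone {j}"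
      by (rule gram_cone_merge[OF empty.prems(3)]) simp
    then show "(\<lambda>\<sigma>. f (\<sigma>(i := \<sigma> j))) \<in> borel_measurable (?P {j})"
      by (intro borel_measurable_integrable gram_cone_integrable) auto
    show "AE \<sigma> in ?P {j}. f (\<lambda>_. ?u) = f (\<sigma>(i := \<sigma> j))"
      using AE_PiM_sphere_measure_norm[OF fin(2)]
    proof eventually_elim
      case (elim \<sigma>)
      have "f (\<sigma>(i := \<sigma> j)) = f (\<lambda>_. \<sigma> j)"
        by (rule gram_cone_cong[OF empty.prems(3)]) auto
      also have "\<dots> = f (\<lambda>_. ?u)"
        using elim by (intro gram_cone_diagonal_eq[OF empty.prems(3)]) auto
      finally show ?case by simp
    qed
  qed simp
  finally show ?case .
next
  case (insert k J)
  let ?P = "\<lambda>I. PiM I (\<lambda>_::'i. sphere_measure :: (real^'n) measure)"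
  have sw: "insert i (insert j (insert k J)) = insert k (insert i (insert j J))"
    "insert j (insert k J) = insert k (insert j J)" by auto
  have fk: "f \<in> gram_cone (insert k (insert i (insert j J)))"
    using insert.prems(3) by (simp only: sw(1))
  let ?g = "\<lambda>\<sigma>. \<integral>x. f (\<sigma>(k := x)) \<partial>sphere_measure"
  have merged: "(\<lambda>\<sigma>. f (\<sigma>(i := \<sigma> j))) \<in> gram_cone (insert k (insert j J))"
    by (rule gram_cone_merge) (use fk in \<open>auto simp: insert_commute\<close>)
  have "integral\<^sup>L (?P (insert i (insert j (insert k J)))) f = integral\<^sup>L (?P (insert i (insert j J))) ?g"
    unfolding sw(1) by (rule gram_cone_integral_insert) (use insert fk in auto)
  also have "\<dots> \<le> (\<integral>\<sigma>. ?g (\<sigma>(i := \<sigma> j)) \<partial>?P (insert j J))"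
  proof (rule insert.IH)
    show "?g \<in> gram_cone (insert i (insert j J))"
      by (rule gram_cone_integral_update[OF _ _ fk]) (use insert in auto)
  qed (use insert in auto)
  \<comment> \<open>Since \<open>k\<close> differs from \<open>i\<close> and \<open>j\<close>,
    updating vertex \<open>k\<close> commutes with merging \<open>i\<close> into
    \<open>j\<close>.\<close>
  also have "\<dots> = (\<integral>\<sigma>. (\<integral>x. f ((\<sigma>(k := x))(i := (\<sigma>(k := x)) j)) \<partial>sphere_measure) \<partial>?P (insert j J))"
    using insert.prems by (simp add: fun_upd_twist[where a=i and c=k] fun_upd_other del: fun_upd_apply)
  also have "\<dots> = (\<integral>\<sigma>. f (\<sigma>(i := \<sigma> j)) \<partial>?P (insert j (insert k J)))"
    unfolding sw(2) by (rule gram_cone_integral_insert[OF _ _ merged, symmetric]) (use insert in auto)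
  finally show ?case .
qed

section \<open>The correlation inequality\<close>

lemma posmono_subset_gram_cone: "posmono N \<subseteq> gram_cone {..<N}"
proof
  fix f :: "(nat \<Rightarrow> real^'n) \<Rightarrow> real"
  assume "f \<in> posmono N"
  then obtain K :: "nat set" and c e where "\<forall>k\<in>K. c k > 0"
    and f: "f = (\<lambda>\<sigma>. \<Sum>k\<in>K. c k * monomial N (e k) \<sigma>)"
    unfolding posmono_def by blast
  then show "f \<in> gram_cone {..<N}"
    unfolding f monomial_def
    by (intro gram_cone_sum gram_cone_scale gram_cone_prod gram_cone_power gram_cone_inner) auto
qed

text \<open>Vertices in \<open>{N..<N + N}\<close> carry the second copy. Fubini separates the two
  blocks, and a shift by \<open>N\<close> identifies their product measures.\<close>

lemma integral_sphere_prod_copies: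
  fixes f g :: "(nat \<Rightarrow> real^'n) \<Rightarrow> real"
  assumes f: "f \<in> gram_cone {..<N}" and g: "g \<in> gram_cone {..<N}"
  shows "(\<integral>\<sigma>. f \<sigma> * g (\<lambda>i. \<sigma> (N + i)) \<partial>sphere_prod (N + N))
      = integral\<^sup>L (sphere_prod N) f * integral\<^sup>L (sphere_prod N) g"
proof -
  let ?P = "\<lambda>I. PiM I (\<lambda>_::nat. sphere_measure :: (real^'n) measure)"
  let ?J = "{N..<N + N}"
  let ?t = "\<lambda>\<omega>. \<lambda>n\<in>{..<N}. \<omega> (N + n)"
  have un: "{..<N + N} = {..<N} \<union> ?J" by auto
  have "(\<lambda>\<sigma>. f \<sigma> * g (\<lambda>i. \<sigma> (N + i))) \<in> gram_cone {..<N + N}"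
    by (intro gram_cone_mult gram_cone_reindex[OF g] gram_cone_reindex[OF f, where r="\<lambda>i. i"]) auto
  then have "(\<integral>\<sigma>. f \<sigma> * g (\<lambda>i. \<sigma> (N + i)) \<partial>?P {..<N + N})
      = (\<integral>x. (\<integral>y. f (merge {..<N} ?J (x, y)) * g (\<lambda>i. merge {..<N} ?J (x, y) (N + i)) \<partial>?P ?J) \<partial>?P {..<N})"
    unfolding un by (intro sphere_product.product_integral_fold gram_cone_integrable) auto
  also have "\<dots> = (\<integral>x. (\<integral>y. f x * g (?t y) \<partial>?P ?J) \<partial>?P {..<N})"
    by (intro Bochner_Integration.integral_cong refl arg_cong2[where f="(*)"] gram_cone_cong[OF f] gram_cone_cong[OF g])
      (auto simp: merge_def)
  also have "\<dots> = integral\<^sup>L (?P {..<N}) f * (\<integral>y. g (?t y) \<partial>?P ?J)"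
    by simp
  also have "(\<integral>y. g (?t y) \<partial>?P ?J) = integral\<^sup>L (distr (?P ?J) (?P {..<N}) ?t) g"
  proof (rule integral_distr[symmetric])
    show "?t \<in> measurable (?P ?J) (?P {..<N})"
      by (intro measurable_restrict measurable_component_singleton) auto
    show "g \<in> borel_measurable (?P {..<N})"
      using gram_cone_integrable[OF _ g] by (auto dest: borel_measurable_integrable)
  qed
  also have "distr (?P ?J) (?P {..<N}) ?t = ?P {..<N}"
    using distr_PiM_reindex[of ?J "\<lambda>_. sphere_measure :: (real^'n) measure" "\<lambda>n. N + n" "{..<N}"]
    by (auto simp: prob_space_sphere_measure inj_on_def)
  finally show ?thesis
    by (simp add: sphere_prod_def)
qed

lemma integral_sphere_prod_correlation:
  fixes f g :: "(nat \<Rightarrow> real^'n) \<Rightarrow> real"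
  assumes f: "f \<in> gram_cone {..<N}" and g: "g \<in> gram_cone {..<N}"
  shows "integral\<^sup>L (sphere_prod N) f * integral\<^sup>L (sphere_prod N) g
      \<le> (\<integral>\<sigma>. f \<sigma> * g \<sigma> \<partial>sphere_prod N)"
proof -
  \<comment> \<open>\<open>h k\<close> interpolates: \<open>g\<close> takes its first
    \<open>k\<close> vertices from the second copy. So \<open>h N\<close> uses independent copies,
    while \<open>h 0\<close> is the product of \<open>f\<close> and \<open>g\<close> on the same
    vertices.\<close>
  define h where "h k \<sigma> = f \<sigma> * g (\<lambda>i. \<sigma> (if i < k then N + i else i))" for k and \<sigma> :: "nat \<Rightarrow> real^'n"
  have h: "h k \<in> gram_cone {..<N + k}" for k
    unfolding h_def
    by (intro gram_cone_mult gram_cone_reindex[OF g] gram_cone_reindex[OF f, where r="\<lambda>i. i"]) auto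
  have step: "integral\<^sup>L (sphere_prod (N + Suc k)) (h (Suc k)) \<le> integral\<^sup>L (sphere_prod (N + k)) (h k)"
    if k: "k < N" for k
  proof -
    \<comment> \<open>Passing from \<open>h (Suc k)\<close> to \<open>h k\<close> merges vertex
      \<open>N + k\<close> into vertex \<open>k\<close>; \<open>J\<close> holds the remaining
      vertices.\<close>
    define J where "J = {..<N + k} - {k}"
    have J: "{..<N + Suc k} = insert (N + k) (insert k J)" "{..<N + k} = insert k J"
      using k by (auto simp: J_def)
    have "integral\<^sup>L (sphere_prod (N + Suc k)) (h (Suc k))
        \<le> (\<integral>\<sigma>. h (Suc k) (\<sigma>(N + k := \<sigma> k)) \<partial>sphere_prod (N + k))"
      unfolding sphere_prod_def J
      by (rule gram_cone_integral_merge_le) (use k h[of "Suc k", unfolded J] in \<open>auto simp: J_def\<close>)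
    also have "(\<lambda>\<sigma>. h (Suc k) (\<sigma>(N + k := \<sigma> k))) = h k"
    proof
      fix \<sigma> :: "nat \<Rightarrow> real^'n"
      show "h (Suc k) (\<sigma>(N + k := \<sigma> k)) = h k \<sigma>"
        unfolding h_def
        by (intro arg_cong2[where f="(*)"] gram_cone_cong[OF f] gram_cone_cong[OF g])
          (auto simp: less_Suc_eq)
    qed
    finally show ?thesis .
  qed
  have "integral\<^sup>L (sphere_prod (N + k)) (h k) \<le> integral\<^sup>L (sphere_prod N) (h 0)" if "k \<le> N" for k
    using that
  proof (induction k)
    case (Suc k)
    then show ?case using step[of k] by simp
  qed simp
  from this[of N] have "integral\<^sup>L (sphere_prod (N + N)) (h N) \<le> integral\<^sup>L (sphere_prod N) (h 0)"
    by simp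
  moreover have "h N = (\<lambda>\<sigma>. f \<sigma> * g (\<lambda>i. \<sigma> (N + i)))"
    unfolding h_def by (intro ext arg_cong2[where f="(*)"] refl gram_cone_cong[OF g]) auto
  moreover have "h 0 = (\<lambda>\<sigma>. f \<sigma> * g \<sigma>)"
    unfolding h_def by simp
  ultimately show ?thesis
    using integral_sphere_prod_copies[OF f g] by simp
qed

theorem theorem1:
  fixes N :: nat and f g :: "(nat \<Rightarrow> real^'n) \<Rightarrow> real"
  assumes "CARD('n) \<ge> 2" and "N \<ge> 1"
    and "f \<in> posmono N" and "g \<in> posmono N"
  shows "Exp N f \<ge> 0 \<and> Exp N (\<lambda>\<sigma>. f \<sigma> * g \<sigma>) \<ge> Exp N f * Exp N g"
proof -
  have f: "f \<in> gram_cone {..<N}" and g: "g \<in> gram_cone {..<N}"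
    using assms(3,4) posmono_subset_gram_cone by blast+
  have "Exp N f \<ge> 0"
    unfolding Exp_def sphere_prod_def by (intro gram_cone_integral_nonneg f finite_lessThan)
  moreover have "Exp N f * Exp N g \<le> Exp N (\<lambda>\<sigma>. f \<sigma> * g \<sigma>)"
    unfolding Exp_def by (rule integral_sphere_prod_correlation[OF f g])
  ultimately show ?thesis by simp
qed

end
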